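(* Let $b\ge3$ be an integer and let $D\subset\{0,1,\dots,b-1\}$ with $2\le\#D<b$. Let $\gamma=\frac{s}{r}b^{\ell}$ be a rational number, where $r\in\mathbb{N}$, $\ell\in\mathbb{Z}$, $s\in\mathbb{Z}\setminus\{0\}$ are such that $|s|\ne r$ and $\gcd(s,r)=\gcd(sr,b)=1$. Let $q\in\mathbb{N}$ with $$q>\frac{\log(|s|+r)}{\log(b/(\#D))}+1.$$ Then for every $\alpha\in\mathbb{R}$, $$\overline{\dim}_{\rm M}\big((\gamma K_{b,D}+\alpha)\cap K_{b,D}\big)\le\frac{\log((\#D)^q-1)}{q\log b}.$$
   Context: $\mathbb{N}=\{1,2,3,\dots\}$, and $\#$ denotes cardinality. The missing-digit set with base $b$ and digit set $D$ is $K_{b,D}=\left\{\sum_{j=1}^\infty \varepsilon_j b^{-j}:\varepsilon_j\in D\text{ for all }j\ge1\right\}$. $\gamma K+\alpha=\{\gamma x+\alpha:x\in K\}$. For a non-empty bounded $A\subset\mathbb{R}$, the upper Minkowski dimension is $\overline{\dim}_{\rm M}A=\limsup_{\delta\to0}\frac{\log N_\delta(A)}{-\log\delta}$, where $N_\delta(A)$ is the smallest number of closed intervals of length $\delta$ needed to cover $A$. Convention: $\overline{\dim}_{\rm M}\emptyset=0$. *)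

theory Defs
  imports "HOL-Analysis.Analysis"
begin

(* The digit sequence is indexed from 0, so \<epsilon> j is the digit at position j + 1 after the
   radix point. For D \<subseteq> {0..<b} and b \<ge> 2 the series always converges. *)
definition missing_digit_set :: "nat \<Rightarrow> nat set \<Rightarrow> real set" where
  "missing_digit_set b D =
     {(\<Sum>j. real (\<epsilon> j) / real b ^ Suc j) | \<epsilon>. \<forall>j. \<epsilon> j \<in> D}"

(* A closed interval of length \<delta> is given by its left endpoint. The minimum exists when A is
   bounded and \<delta> > 0; otherwise the value is not meaningful. *)
definition interval_covering_number :: "real \<Rightarrow> real set \<Rightarrow> nat" where
  "interval_covering_number \<delta> A =
     (LEAST n. \<exists>C. finite C \<and> card C = n \<and> A \<subseteq> (\<Union>c\<in>C. {c..c + \<delta>}))"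

(* Intended for bounded A only. *)
definition upper_minkowski_dim :: "real set \<Rightarrow> ereal" where
  "upper_minkowski_dim A =
     (if A = {} then 0
      else Limsup (at_right 0)
             (\<lambda>\<delta>. ereal (ln (real (interval_covering_number \<delta> A)) / (- ln \<delta>))))"

end

theory Submission
  imports Defs
begin

text \<open>
  Writing points of \<open>K\<close> by their first digits, a point \<open>x = \<gamma> y + \<alpha>\<close> of the intersection forces
  \<open>r X - s Y\<close> to lie in a bounded set of integers, where \<open>X\<close> and \<open>Y\<close> are the integers formed by
  the leading digits of \<open>x\<close> and \<open>y\<close>. Such an equation is read from the least significant end in
  blocks of \<open>q\<close> digits: given the current carry, the block of \<open>X\<close> determines the block of \<open>Y\<close> and
  the next carry, since \<open>s\<close> is invertible mod \<open>b\<close>. It remains to see that for every carry at least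
  one of the \<open>(#D)\<^sup>q\<close> blocks is impossible, i.e. that \<open>r D\<^sub>q = s D\<^sub>q + k\<close> mod \<open>b\<^sup>q\<close> fails for the set
  \<open>D\<^sub>q\<close> of all \<open>q\<close>-digit integers.

  Suppose it holds. All carries that occur before the last digit then agree modulo the generator
  \<open>m\<close> of the stabiliser of \<open>D\<close> in \<open>\<int>/b\<close>, so corresponding digits correspond mod \<open>m\<close>. If \<open>m = b\<close>,
  changing only the lowest digit on one side changes only the lowest digit on the other side, and
  \<open>r + |s| < b ^ (q - 1)\<close> turns the congruence into \<open>r (d - d') = s (e - e')\<close>; comparing diameters gives
  \<open>r = |s|\<close>. If \<open>b = m h\<close> with \<open>h \<ge> 2\<close>, then \<open>D\<close> is a union of progressions of length \<open>h\<close> and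
  difference \<open>m\<close>. Adding \<open>m\<close> to the lowest digit on one side adds fixed multiples \<open>m g\<^sub>i\<close> to the digits
  on the other side. Moving through a whole progression leaves no room for \<open>|g\<^sub>i| > 1\<close>, nor for
  \<open>g\<^sub>i \<noteq> 0\<close> with \<open>0 < i < q - 1\<close>, so \<open>r = s g\<^sub>0\<close> and again \<open>r = |s|\<close>.
\<close>

section \<open>Digit expansions of integers\<close>

text \<open>Least significant digit first. The \<open>w i\<close> are arbitrary integers, since
  differences of words, with negative digits, are evaluated as well.\<close>

definition digit_val :: "int \<Rightarrow> nat \<Rightarrow> (nat \<Rightarrow> int) \<Rightarrow> int" where
  "digit_val b n w = (\<Sum>i<n. w i * b ^ i)"

lemma digit_val_0 [simp]: "digit_val b 0 w = 0"
  by (simp add: digit_val_def)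

lemma digit_val_Suc: "digit_val b (Suc n) w = digit_val b n w + b ^ n * w n"
  by (simp add: digit_val_def algebra_simps)

lemma digit_val_cong: "(\<And>i. i < n \<Longrightarrow> w i = w' i) \<Longrightarrow> digit_val b n w = digit_val b n w'"
  by (simp add: digit_val_def)

lemma digit_val_add: "digit_val b (m + n) w = digit_val b m w + b ^ m * digit_val b n (\<lambda>i. w (m + i))"
  by (induction n) (simp_all add: digit_val_Suc algebra_simps power_add)

lemma digit_val_diff: "digit_val b n w - digit_val b n w' = digit_val b n (\<lambda>i. w i - w' i)"
  by (simp add: digit_val_def sum_subtractf algebra_simps)

lemma digit_val_mult: "digit_val b n (\<lambda>i. c * w i) = c * digit_val b n w"
  by (simp add: digit_val_def sum_distrib_left algebra_simps)

lemma digit_val_single: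
  assumes "n > 0" "\<And>i. 0 < i \<Longrightarrow> i < n \<Longrightarrow> w i = 0"
  shows "digit_val b n w = w 0"
proof -
  have "digit_val b (1 + (n - 1)) w = w 0 + b * digit_val b (n - 1) (\<lambda>i. w (1 + i))"
    by (subst digit_val_add) (simp add: digit_val_def)
  also have "digit_val b (n - 1) (\<lambda>i. w (1 + i)) = 0"
    using assms by (simp add: digit_val_def)
  finally show ?thesis using assms by simp
qed

lemma int_dvd_abs_less_imp_0:
  fixes a x :: int
  assumes "a dvd x" "\<bar>x\<bar> < a"
  shows "x = 0"
  using dvd_imp_le_int[OF _ assms(1)] assms(2) by linarith

text \<open>Uniqueness of expansions with signed digits: modulo \<open>b\<close> only
  \<open>c 0\<close> survives, and it is too small to be a nonzero multiple of \<open>b\<close>.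
  Cancelling one factor \<open>b\<close> leaves the shifted digits.\<close>

lemma digit_val_dvd_imp_0:
  fixes b :: int
  assumes "b > 0" "\<And>i. i < n \<Longrightarrow> \<bar>c i\<bar> < b" "b ^ n dvd digit_val b n c" "i < n"
  shows "c i = 0"
  using assms(2-)
proof (induction n arbitrary: c i)
  case (Suc n)
  have split: "digit_val b (Suc n) c = c 0 + b * digit_val b n (\<lambda>i. c (Suc i))"
    using digit_val_add[of b 1 n c] by (simp add: digit_val_def)
  have "b dvd c 0 + b * digit_val b n (\<lambda>i. c (Suc i))"
    using Suc.prems(2) unfolding split by (metis dvd_mult_left power_Suc)
  then have "b dvd c 0"
    by (simp add: dvd_add_left_iff)
  then have c0: "c 0 = 0"
    using Suc.prems(1)[of 0] int_dvd_abs_less_imp_0 by blast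
  then have "b ^ n dvd digit_val b n (\<lambda>i. c (Suc i))"
    using Suc.prems(2) \<open>b > 0\<close> unfolding split by simp
  then have "i > 0 \<Longrightarrow> c (Suc (i - 1)) = 0"
    using Suc.IH[of "\<lambda>i. c (Suc i)" "i - 1"] Suc.prems(1,3) by simp
  then show ?case
    using c0 by (cases "i = 0") auto
qed simp

text \<open>Division with remainder by the least positive element of \<open>S\<close>: the remainder
  lies in \<open>S\<close> and is smaller, so it vanishes.\<close>

lemma int_subgroup_generator:
  fixes S :: "int set"
  assumes mult: "\<And>x g. g \<in> S \<Longrightarrow> x * g \<in> S"
    and add: "\<And>g g'. g \<in> S \<Longrightarrow> g' \<in> S \<Longrightarrow> g + g' \<in> S"
    and "b \<in> S" "b > 0"
  obtains m where "m > 0" "\<And>g. g \<in> S \<longleftrightarrow> m dvd g"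
proof -
  define n where "n = (LEAST n. 0 < n \<and> int n \<in> S)"
  have n: "0 < n \<and> int n \<in> S"
    unfolding n_def by (rule LeastI[of _ "nat b"]) (use assms in auto)
  have "g \<in> S \<longleftrightarrow> int n dvd g" for g
  proof
    assume g: "g \<in> S"
    have "g mod int n = g + (- (g div int n)) * int n"
      by (simp add: minus_div_mult_eq_mod [symmetric])
    then have "g mod int n \<in> S"
      using add mult g n by metis
    moreover have "g mod int n < int n" "0 \<le> g mod int n"
      using n by auto
    ultimately have "g mod int n = 0"
      using not_less_Least[of "nat (g mod int n)" "\<lambda>n. 0 < n \<and> int n \<in> S", folded n_def]
      by force
    then show "int n dvd g" by auto
  next
    assume "int n dvd g"
    then show "g \<in> S" using n mult by (metis dvdE mult.commute)
  qed
  then show thesis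
    using that[of "int n"] n by auto
qed

section \<open>The stabiliser of the digit set modulo the base\<close>

locale digit_pair =
  fixes b r s :: int and D :: "int set"
  assumes D_subset: "D \<subseteq> {0..<b}"
    and card_D: "2 \<le> card D" "int (card D) < b"
    and coprime_r: "coprime r b"
    and coprime_s: "coprime s b"
begin

text \<open>Words are infinite, and \<open>digit_val b n\<close> reads only the first
  \<open>n\<close> digits, so one set serves all lengths.\<close>

definition words :: "(nat \<Rightarrow> int) set" where
  "words = {w. \<forall>i. w i \<in> D}"

lemma wordsD: "w \<in> words \<Longrightarrow> w i \<in> D"
  by (simp add: words_def)

lemma words_upd: "w \<in> words \<Longrightarrow> d \<in> D \<Longrightarrow> w(n := d) \<in> words"
  by (simp add: words_def)

lemma finite_D: "finite D"
  using D_subset finite_subset by blast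

lemma b_pos: "b > 0"
  using card_D by linarith

lemma digit_bounds: "d \<in> D \<Longrightarrow> 0 \<le> d \<and> d < b"
  using D_subset by auto

lemma digit_diff: "d \<in> D \<Longrightarrow> e \<in> D \<Longrightarrow> \<bar>d - e\<bar> < b"
  using digit_bounds[of d] digit_bounds[of e] by auto

lemma digit_eqI: "d \<in> D \<Longrightarrow> e \<in> D \<Longrightarrow> b dvd d - e \<Longrightarrow> d = e"
  using int_dvd_abs_less_imp_0[of b "d - e"] digit_diff[of d e] by simp

lemma dvd_r_cancel: "b ^ n dvd r * x \<longleftrightarrow> b ^ n dvd x"
  using coprime_r by (intro coprime_dvd_mult_right_iff) (simp add: coprime_commute)

lemma dvd_s_cancel: "b ^ n dvd s * x \<longleftrightarrow> b ^ n dvd x"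
  using coprime_s by (intro coprime_dvd_mult_right_iff) (simp add: coprime_commute)

lemmas dvd_r_cancel1 = dvd_r_cancel[of 1, simplified]
lemmas dvd_s_cancel1 = dvd_s_cancel[of 1, simplified]

text \<open>Inclusion already means equality, because translation modulo \<open>b\<close> is
  injective on the finite set \<open>D\<close>.\<close>

definition stabiliser :: "int set" where
  "stabiliser = {g. \<forall>d\<in>D. (d + g) mod b \<in> D}"

lemma stabiliser_cong: "g \<in> stabiliser \<Longrightarrow> b dvd g - g' \<Longrightarrow> g' \<in> stabiliser"
  
proof -
  assume g: "g \<in> stabiliser" and "b dvd g - g'"
  then have "g mod b = g' mod b" by (simp add: mod_eq_dvd_iff)
  then have "(d + g) mod b = (d + g') mod b" for d
    by (metis mod_add_right_eq)
  then show ?thesis using g by (simp add: stabiliser_def)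
qed

lemma stabiliser_add: "g \<in> stabiliser \<Longrightarrow> g' \<in> stabiliser \<Longrightarrow> g + g' \<in> stabiliser"
proof -
  assume g: "g \<in> stabiliser" and g': "g' \<in> stabiliser"
  have "(d + (g + g')) mod b \<in> D" if "d \<in> D" for d
  proof -
    have "((d + g) mod b + g') mod b \<in> D"
      using g g' that by (simp add: stabiliser_def)
    then show ?thesis by (simp add: mod_add_left_eq add.assoc)
  qed
  then show ?thesis by (simp add: stabiliser_def)
qed

lemma zero_in_stabiliser: "0 \<in> stabiliser"
  using digit_bounds by (auto simp: stabiliser_def)

text \<open>Nonnegative multiples follow by induction. Any other factor may be replaced by its
  residue modulo \<open>b\<close>.\<close>

lemma stabiliser_mult:
  assumes "g \<in> stabiliser"
  shows "x * g \<in> stabiliser"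
proof -
  have nat: "int n * g \<in> stabiliser" for n
    by (induction n) (auto simp: zero_in_stabiliser stabiliser_add assms distrib_right)
  have "int (nat (x mod b)) * g \<in> stabiliser"
    by (rule nat)
  moreover have "b dvd (x mod b) * g - x * g"
    by (metis dvd_mult2 left_diff_distrib mod_eq_dvd_iff mod_mod_trivial)
  ultimately show ?thesis
    using stabiliser_cong b_pos by simp
qed

lemma stabiliser_generator:
  obtains m where "m > 1" "m dvd b" "\<And>g. g \<in> stabiliser \<longleftrightarrow> m dvd g"
proof -
  have "b \<in> stabiliser"
    using stabiliser_cong[OF zero_in_stabiliser, of b] by simp
  then obtain m where m: "m > 0" "\<And>g. g \<in> stabiliser \<longleftrightarrow> m dvd g"
    using int_subgroup_generator[of stabiliser b] stabiliser_mult stabiliser_add b_pos by blast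
  \<comment> \<open>If all translations preserved the nonempty set \<open>D\<close>, it would
    contain every residue, against \<open>card D < b\<close>.\<close>
  have "m \<noteq> 1"
  proof
    assume "m = 1"
    obtain d where d: "d \<in> D" using card_D by fastforce
    have "x \<in> D" if "x \<in> {0..<b}" for x
    proof -
      have "x - d \<in> stabiliser" using m \<open>m = 1\<close> by simp
      then have "(d + (x - d)) mod b \<in> D" using d unfolding stabiliser_def by blast
      then show ?thesis using that by simp
    qed
    then have "D = {0..<b}" using D_subset by auto
    then show False using card_D b_pos by simp
  qed
  then show thesis
    using that[of m] m \<open>b \<in> stabiliser\<close> by simp
qed

section \<open>Carries after which every digit has a partner\<close>

definition full_carry :: "int \<Rightarrow> bool" where
  "full_carry c \<longleftrightarrow> (\<forall>d\<in>D. \<exists>e\<in>D. b dvd c + r * d - s * e)"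

text \<open>The choice of a partner is injective because \<open>r\<close> is invertible modulo
  \<open>b\<close>, and an injective self-map of the finite set \<open>D\<close> is onto.\<close>

lemma full_carry_surj:
  assumes "full_carry c" "e \<in> D"
  shows "\<exists>d\<in>D. b dvd c + r * d - s * e"
proof -
  obtain f where f: "\<And>d. d \<in> D \<Longrightarrow> f d \<in> D \<and> b dvd c + r * d - s * f d"
    using assms(1) unfolding full_carry_def by metis
  have "inj_on f D"
  proof (rule inj_onI)
    fix d d' assume d: "d \<in> D" "d' \<in> D" "f d = f d'"
    have "b dvd (c + r * d - s * f d) - (c + r * d' - s * f d')"
      using f[OF d(1)] f[OF d(2)] by (blast intro: dvd_diff)
    then have "b dvd r * (d - d')" using d(3) by (simp add: algebra_simps)
    then show "d = d'" using digit_eqI d dvd_r_cancel1 by blast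
  qed
  then have "f ` D = D"
    using f finite_D by (intro endo_inj_surj) auto
  then obtain d where "d \<in> D" "e = f d"
    using assms(2) by blast
  then show ?thesis using f by metis
qed

text \<open>Modulo \<open>b\<close> both \<open>c + r D\<close> and \<open>c' + r D\<close> equal
  \<open>s D\<close>. Hence translation by \<open>c - c'\<close> preserves \<open>s D\<close>, and
  dividing by \<open>s\<close> gives an element of the stabiliser of \<open>D\<close>.\<close>

lemma full_carry_diff:
  assumes "full_carry c" "full_carry c'"
  shows "c - c' \<in> stabiliser"
proof -
  \<comment> \<open>\<open>si\<close> is an inverse of \<open>s\<close> modulo
    \<open>b\<close>.\<close>
  obtain si v where "si * s + v * b = 1"
    using bezout_int[of s b] coprime_imp_gcd_eq_1[OF coprime_s] by metis
  then have "s * si - 1 = b * (- v)" by (simp add: algebra_simps)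
  then have si': "b dvd s * si - 1" by (rule dvdI)
  have "(e + si * (c - c')) mod b \<in> D" if e: "e \<in> D" for e
  proof -
    obtain d where d: "d \<in> D" "b dvd c' + r * d - s * e"
      using full_carry_surj[OF assms(2) e] by blast
    obtain e' where e': "e' \<in> D" "b dvd c + r * d - s * e'"
      using assms(1) d(1) by (auto simp: full_carry_def)
    have "b dvd (c + r * d - s * e') - (c' + r * d - s * e)"
      using d(2) e'(2) by (rule dvd_diff[rotated])
    then have 1: "b dvd (c - c') + s * (e - e')" by (simp add: algebra_simps)
    have "b dvd (s * si - 1) * (c - c') + ((c - c') + s * (e - e'))"
      using dvd_mult2[OF si'] 1 by (rule dvd_add)
    then have "b dvd s * ((e + si * (c - c')) - e')" by (simp add: algebra_simps)
    then have "(e + si * (c - c')) mod b = e' mod b"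
      using dvd_s_cancel1 mod_eq_dvd_iff by blast
    then show ?thesis using e' digit_bounds by simp
  qed
  then have "si * (c - c') \<in> stabiliser" by (simp add: stabiliser_def)
  then have "s * (si * (c - c')) \<in> stabiliser" by (rule stabiliser_mult)
  then show ?thesis
  proof (rule stabiliser_cong)
    show "b dvd s * (si * (c - c')) - (c - c')"
      using si' by (metis dvd_mult2 left_diff_distrib mult.assoc mult_1)
  qed
qed

end

section \<open>Every residue misses a block of digits\<close>

text \<open>The situation to be refuted when \<open>r\<close> and \<open>s\<close> differ in
  absolute value and are small: for the incoming carry \<open>k\<close>, no block of
  \<open>q\<close> digits is impossible.\<close>

locale saturated_digit_pair = digit_pair +
  fixes q :: nat and k :: int
  assumes saturated: "w \<in> words \<Longrightarrow> \<exists>z\<in>words. b ^ q dvd r * digit_val b q w - s * digit_val b q z - k"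
begin

section \<open>Matching words and their carries\<close>

definition match :: "(nat \<Rightarrow> int) \<Rightarrow> (nat \<Rightarrow> int) \<Rightarrow> bool" where
  "match w z \<longleftrightarrow> w \<in> words \<and> z \<in> words \<and> b ^ q dvd r * digit_val b q w - s * digit_val b q z - k"

text \<open>The state after the \<open>n\<close> lowest digits have been read. For matching words
  and \<open>n \<le> q\<close> the division is exact.\<close>

definition carry :: "nat \<Rightarrow> (nat \<Rightarrow> int) \<Rightarrow> (nat \<Rightarrow> int) \<Rightarrow> int" where
  "carry n w z = (r * digit_val b n w - s * digit_val b n z - k) div b ^ n"

lemma match_ex: "w \<in> words \<Longrightarrow> \<exists>z. match w z"
  using saturated by (auto simp: match_def)

lemma match_words: "match w z \<Longrightarrow> w i \<in> D" "match w z \<Longrightarrow> z i \<in> D"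
  by (auto simp: match_def wordsD)

lemma match_dvd:
  assumes "match w z" "n \<le> q"
  shows "b ^ n dvd r * digit_val b n w - s * digit_val b n z - k"
proof -
  define u v where "u = digit_val b (q - n) (\<lambda>i. w (n + i))" and "v = digit_val b (q - n) (\<lambda>i. z (n + i))"
  have "digit_val b (n + (q - n)) w = digit_val b n w + b ^ n * u"
    "digit_val b (n + (q - n)) z = digit_val b n z + b ^ n * v"
    unfolding u_def v_def by (rule digit_val_add)+
  then have "r * digit_val b q w - s * digit_val b q z - k
      = (r * digit_val b n w - s * digit_val b n z - k) + b ^ n * (r * u - s * v)"
    using assms(2) by (simp add: algebra_simps)
  moreover have "b ^ n dvd r * digit_val b q w - s * digit_val b q z - k"
    using assms by (meson dvd_trans le_imp_power_dvd match_def)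
  ultimately show ?thesis
    by (metis dvd_add_left_iff dvd_triv_left)
qed

lemma carry_mult:
  assumes "match w z" "n \<le> q"
  shows "b ^ n * carry n w z = r * digit_val b n w - s * digit_val b n z - k"
  using match_dvd[OF assms] by (simp add: carry_def)

lemma carry_Suc:
  assumes "match w z" "n < q"
  shows "b * carry (Suc n) w z = carry n w z + r * w n - s * z n"
proof -
  have "b ^ n * (b * carry (Suc n) w z) = b ^ n * (carry n w z + r * w n - s * z n)"
    using carry_mult[of w z n] carry_mult[of w z "Suc n"] assms
    by (simp add: digit_val_Suc algebra_simps)
  then show ?thesis
    using b_pos by simp
qed

lemma dvd_carry:
  assumes "match w z" "n < q"
  shows "b dvd carry n w z + r * w n - s * z n"
  using carry_Suc[OF assms] by (metis dvd_triv_left)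

lemma carry_cong:
  assumes "\<And>i. i < n \<Longrightarrow> w i = w' i" "\<And>i. i < n \<Longrightarrow> z i = z' i"
  shows "carry n w z = carry n w' z'"
  unfolding carry_def using digit_val_cong[of n w w'] digit_val_cong[of n z z'] assms by simp

text \<open>Digit by digit, equal carries and equal digits of \<open>w\<close> fix
  \<open>s * z n\<close> modulo \<open>b\<close>, hence \<open>z n\<close>.\<close>

lemma match_prefix:
  assumes "match w z" "match w' z'" "n \<le> q" "\<And>i. i < n \<Longrightarrow> w i = w' i" "i < n"
  shows "z i = z' i"
  using assms(3-)
proof (induction n arbitrary: i)
  case (Suc n)
  have eq: "z i = z' i" if "i < n" for i
    using Suc.IH Suc.prems that by simp
  then have c: "carry n w z = carry n w' z'"
    using Suc.prems by (intro carry_cong) auto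
  have "b dvd (carry n w' z' + r * w' n - s * z' n) - (carry n w z + r * w n - s * z n)"
    using dvd_carry[OF assms(1), of n] dvd_carry[OF assms(2), of n] Suc.prems(1)
    by (blast intro: dvd_diff Suc_le_lessD)
  moreover have "\<dots> = s * (z n - z' n)"
    using c Suc.prems(2)[of n] by (simp add: algebra_simps)
  ultimately have "b dvd z n - z' n"
    using dvd_s_cancel1 by simp
  then have "z n = z' n"
    using digit_eqI match_words assms by blast
  then show ?case using eq Suc.prems by (cases "i = n") auto
qed simp

text \<open>Saturation supplies a partner for the changed word. Its digits below \<open>n\<close>,
  and with them the carry at \<open>n\<close>, are forced; its higher digits may change.\<close>

lemma match_upd:
  assumes "match w z" "n < q" "d \<in> D"
  obtains z' where "match (w(n := d)) z'" "\<And>i. i < n \<Longrightarrow> z' i = z i"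
    "carry n (w(n := d)) z' = carry n w z"
proof -
  have "w(n := d) \<in> words" using assms words_upd by (simp add: match_def)
  then obtain z' where z': "match (w(n := d)) z'" using match_ex by blast
  have eq: "z' i = z i" if "i < n" for i
    using match_prefix[OF z' assms(1), of n] that assms(2) by simp
  then show thesis
    using that[of z'] z' carry_cong[of n "w(n := d)" w z' z] by simp
qed

text \<open>Digit \<open>n\<close> can be changed freely without affecting the carry that precedes
  it, so each digit must find a partner there.\<close>

lemma full_carry_carry:
  assumes "match w z" "n < q"
  shows "full_carry (carry n w z)"
  unfolding full_carry_def
proof
  fix d assume "d \<in> D"
  then obtain z' where z': "match (w(n := d)) z'" "carry n (w(n := d)) z' = carry n w z"
    using match_upd[OF assms] by metis
  then show "\<exists>e\<in>D. b dvd carry n w z + r * d - s * e"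
    using dvd_carry[OF z'(1) assms(2)] match_words(2)[OF z'(1)] by auto
qed

lemma match_hit_digit:
  assumes "match w z" "n < q" "e \<in> D"
  obtains d z' where "d \<in> D" "match (w(n := d)) z'" "z' n = e"
proof -
  obtain d where d: "d \<in> D" "b dvd carry n w z + r * d - s * e"
    using full_carry_surj[OF full_carry_carry] assms by blast
  obtain z' where z': "match (w(n := d)) z'" "carry n (w(n := d)) z' = carry n w z"
    using match_upd[OF assms(1,2) d(1)] by metis
  have "b dvd carry n w z + r * d - s * z' n"
    using dvd_carry[OF z'(1) assms(2)] z'(2) by simp
  then have "b dvd (carry n w z + r * d - s * e) - (carry n w z + r * d - s * z' n)"
    using d(2) by (blast intro: dvd_diff)
  then have "b dvd s * (z' n - e)"
    by (simp add: algebra_simps)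
  then have "z' n = e"
    using digit_eqI assms(3) match_words(2)[OF z'(1)] dvd_s_cancel1 by blast
  then show thesis using that d z' by blast
qed

text \<open>The two carries at \<open>i\<close> are both full, so they agree modulo \<open>m\<close>
  whatever the lower digits are. Then \<open>s\<close> cancels modulo \<open>m\<close>.\<close>

lemma match_residue:
  assumes "match w z" "match w' z'" "i < q"
    and m: "m dvd b" "\<And>g. g \<in> stabiliser \<longleftrightarrow> m dvd g"
    and "m dvd w' i - w i"
  shows "m dvd z' i - z i"
proof -
  have "m dvd carry i w' z' - carry i w z"
    using full_carry_diff full_carry_carry assms by blast
  moreover have "b dvd (carry i w' z' + r * w' i - s * z' i) - (carry i w z + r * w i - s * z i)"
    using dvd_carry assms by (blast intro: dvd_diff)
  then have "m dvd (carry i w' z' + r * w' i - s * z' i) - (carry i w z + r * w i - s * z i)"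
    using m(1) dvd_trans by blast
  moreover have "m dvd r * (w' i - w i)" using assms by simp
  ultimately have "m dvd (carry i w' z' - carry i w z) + r * (w' i - w i)
      - ((carry i w' z' + r * w' i - s * z' i) - (carry i w z + r * w i - s * z i))"
    by (blast intro: dvd_diff dvd_add)
  then have "m dvd s * (z' i - z i)" by (simp add: algebra_simps)
  moreover have "coprime m s"
    using coprime_s m(1) by (metis coprime_commute coprime_divisors dvd_refl)
  ultimately show ?thesis
    by (simp add: coprime_dvd_mult_right_iff)
qed

lemma match_diff_dvd:
  assumes "match w z" "match w' z'"
  shows "b ^ q dvd r * digit_val b q (\<lambda>i. w' i - w i) - s * digit_val b q (\<lambda>i. z' i - z i)"
proof -
  have "b ^ q dvd (r * digit_val b q w' - s * digit_val b q z' - k) - (r * digit_val b q w - s * digit_val b q z - k)"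
    using assms unfolding match_def by (blast intro: dvd_diff)
  then show ?thesis
    by (simp add: digit_val_diff[symmetric] algebra_simps)
qed

lemma match_exists: obtains w z where "match w z"
proof -
  obtain d where "d \<in> D" using card_D by fastforce
  then have "(\<lambda>_. d) \<in> words" by (simp add: words_def)
  then show thesis using match_ex that by blast
qed

section \<open>The case of a trivial stabiliser\<close>

lemma match_residue_trivial:
  assumes "\<And>g. g \<in> stabiliser \<longleftrightarrow> b dvd g" and "q > 0" and small: "\<bar>r\<bar> + \<bar>s\<bar> < b ^ (q - 1)"
    and "match w z" "match w' z'" "\<And>i. 0 < i \<Longrightarrow> w' i = w i"
  shows "r * (w' 0 - w 0) = s * (z' 0 - z 0)"
proof -
  \<comment> \<open>With \<open>m = b\<close>, corresponding digits above the lowest one are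
    congruent modulo \<open>b\<close>, hence equal.\<close>
  have "z' i = z i" if "0 < i" "i < q" for i
    using match_residue[OF assms(4,5) that(2), of b] assms(1,6) that
    by (auto intro: digit_eqI match_words assms(4,5))
  then have "digit_val b q (\<lambda>i. z' i - z i) = z' 0 - z 0" "digit_val b q (\<lambda>i. w' i - w i) = w' 0 - w 0"
    using assms by (simp_all add: digit_val_single)
  then have dvd: "b ^ q dvd r * (w' 0 - w 0) - s * (z' 0 - z 0)"
    using match_diff_dvd[OF assms(4,5)] by simp
  \<comment> \<open>A multiple of \<open>b ^ q\<close> of smaller absolute value must be
    zero.\<close>
  have "\<bar>r * (w' 0 - w 0) - s * (z' 0 - z 0)\<bar> \<le> \<bar>r\<bar> * \<bar>w' 0 - w 0\<bar> + \<bar>s\<bar> * \<bar>z' 0 - z 0\<bar>"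
    by (metis abs_mult abs_triangle_ineq4)
  also have "\<dots> \<le> \<bar>r\<bar> * b + \<bar>s\<bar> * b"
    using digit_diff[of "w' 0" "w 0"] digit_diff[of "z' 0" "z 0"] match_words[OF assms(4)] match_words[OF assms(5)]
    by (intro add_mono mult_left_mono) auto
  also have "\<dots> < b ^ (q - 1) * b"
    using small b_pos by (simp add: distrib_right[symmetric])
  also have "\<dots> = b ^ q"
    using \<open>q > 0\<close> by (metis power_minus_mult)
  finally show ?thesis
    using int_dvd_abs_less_imp_0[OF dvd] by simp
qed

text \<open>Putting the extreme digits of \<open>D\<close> into \<open>w\<close> gives one
  inequality between \<open>\<bar>r\<bar>\<close> and \<open>\<bar>s\<bar>\<close>; forcing them in
  the partner gives the other.\<close>

lemma abs_eq_if_trivial_stabiliser: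
  assumes "\<And>g. g \<in> stabiliser \<longleftrightarrow> b dvd g" and "q > 0" and "\<bar>r\<bar> + \<bar>s\<bar> < b ^ (q - 1)"
  shows "\<bar>r\<bar> = \<bar>s\<bar>"
proof -
  define dM dm where "dM = Max D" and "dm = Min D"
  have "D \<noteq> {}" using card_D by auto
  then have D: "dM \<in> D" "dm \<in> D" and le: "\<And>d. d \<in> D \<Longrightarrow> dm \<le> d \<and> d \<le> dM"
    using finite_D by (auto simp: dM_def dm_def)
  have "dm \<noteq> dM"
  proof
    assume "dm = dM"
    then have "D \<subseteq> {dM}" using le by force
    then show False using card_D card_mono[of "{dM}" D] by simp
  qed
  then have pos: "dM - dm > 0" using le[OF D(1)] by simp
  have le': "\<bar>d - e\<bar> \<le> dM - dm" if "d \<in> D" "e \<in> D" for d e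
    using le[OF that(1)] le[OF that(2)] by linarith
  obtain w z where wz: "match w z" using match_exists by blast
  have eq: "\<bar>r\<bar> * \<bar>w' 0 - w'' 0\<bar> = \<bar>s\<bar> * \<bar>z' 0 - z'' 0\<bar>"
    if "match w' z'" "match w'' z''" "\<And>i. 0 < i \<Longrightarrow> w' i = w'' i" for w' w'' z' z''
    using match_residue_trivial[OF assms that(2,1,3)] by (metis abs_mult)
  obtain z1 where z1: "match (w(0 := dM)) z1" using match_upd[OF wz assms(2) D(1)] by metis
  obtain z2 where z2: "match (w(0 := dm)) z2" using match_upd[OF wz assms(2) D(2)] by metis
  have "\<bar>r\<bar> * (dM - dm) = \<bar>s\<bar> * \<bar>z1 0 - z2 0\<bar>"
    using eq[OF z1 z2] pos by simp
  also have "\<dots> \<le> \<bar>s\<bar> * (dM - dm)"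
    using le' match_words z1 z2 by (intro mult_left_mono) auto
  finally have "\<bar>r\<bar> \<le> \<bar>s\<bar>" using pos by simp
  obtain d3 z3 where z3: "d3 \<in> D" "match (w(0 := d3)) z3" "z3 0 = dM"
    using match_hit_digit[OF wz assms(2) D(1)] by metis
  obtain d4 z4 where z4: "d4 \<in> D" "match (w(0 := d4)) z4" "z4 0 = dm"
    using match_hit_digit[OF wz assms(2) D(2)] by metis
  have "\<bar>s\<bar> * (dM - dm) = \<bar>r\<bar> * \<bar>d3 - d4\<bar>"
    using eq[OF z3(2) z4(2)] pos z3 z4 by simp
  also have "\<dots> \<le> \<bar>r\<bar> * (dM - dm)"
    using le' z3 z4 by (intro mult_left_mono) auto
  finally have "\<bar>s\<bar> \<le> \<bar>r\<bar>" using pos by simp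
  then show ?thesis using \<open>\<bar>r\<bar> \<le> \<bar>s\<bar>\<close> by simp
qed

section \<open>The case of a nontrivial stabiliser\<close>

context
  fixes m h :: int
  assumes gen: "\<And>g. g \<in> stabiliser \<longleftrightarrow> m dvd g"
    and m: "m > 1" and h: "h > 1" and b_eq: "b = m * h" and q: "q > 1"
begin

lemma digit_shift:
  assumes "d \<in> D" "0 \<le> d + m * j" "d + m * j < b"
  shows "d + m * j \<in> D"
proof -
  have "m * j \<in> stabiliser" by (simp add: gen)
  then have "(d + m * j) mod b \<in> D"
    using assms(1) by (simp add: stabiliser_def)
  then show ?thesis using assms by simp
qed

text \<open>Corresponding digits stay congruent modulo \<open>m\<close>, so raising the lowest digit
  by \<open>m\<close> moves each partner digit by a multiple \<open>m * g i\<close>. The bound on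
  \<open>g i\<close> is that on digit differences divided by \<open>m\<close>.\<close>

lemma shift_quotient:
  assumes "match w z" "match (w(0 := w 0 + m)) z'"
  obtains g where "\<And>i. i < q \<Longrightarrow> z' i - z i = m * g i" "\<And>i. i < q \<Longrightarrow> \<bar>g i\<bar> < h"
    "b ^ q dvd m * (r - s * digit_val b q g)"
proof -
  define g where "g i = (z' i - z i) div m" for i
  have g: "z' i - z i = m * g i" if "i < q" for i
  proof -
    have "m dvd z' i - z i"
      by (rule match_residue[OF assms that _ gen]) (simp_all add: b_eq)
    then show ?thesis by (simp add: g_def)
  qed
  have "\<bar>g i\<bar> < h" if "i < q" for i
  proof -
    have "\<bar>m * g i\<bar> < m * h"
      using digit_diff[of "z' i" "z i"] match_words assms g[OF that] b_eq by metis
    then show ?thesis using m by (simp add: abs_mult)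
  qed
  moreover have "digit_val b q (\<lambda>i. (w(0 := w 0 + m)) i - w i) = m"
    using q by (simp add: digit_val_single)
  moreover have "digit_val b q (\<lambda>i. z' i - z i) = m * digit_val b q g"
    using digit_val_cong[of q "\<lambda>i. z' i - z i" "\<lambda>i. m * g i"] g by (simp add: digit_val_mult)
  ultimately show thesis
    using that[of g] g match_diff_dvd[OF assms] by (simp add: algebra_simps)
qed

text \<open>Cancelling \<open>m\<close> from \<open>b ^ q = m * h * b ^ (q - 1)\<close> leaves a
  congruence modulo \<open>b ^ (q - 1)\<close>, which does not see the digit at
  \<open>q - 1\<close>.\<close>

lemma dvd_drop_top_digit:
  assumes "b ^ q dvd m * (x + y * digit_val b q g)"
  shows "b ^ (q - 1) dvd x + y * digit_val b (q - 1) g"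
proof -
  have "b ^ q = m * (h * b ^ (q - 1))"
    using q b_eq by (metis Suc_pred' less_trans mult.assoc power_Suc zero_less_one)
  then have "h * b ^ (q - 1) dvd x + y * digit_val b q g"
    using assms m by simp
  then have "b ^ (q - 1) dvd x + y * digit_val b q g"
    by (rule dvd_mult_right)
  moreover have "x + y * digit_val b q g = (x + y * digit_val b (q - 1) g) + b ^ (q - 1) * (y * g (q - 1))"
    using digit_val_Suc[of b "q - 1" g] q by (simp add: algebra_simps)
  ultimately show ?thesis
    by (metis dvd_add_left_iff dvd_triv_left)
qed

text \<open>The differences of the quotients are below \<open>2 * h \<le> b\<close> in absolute
  value, so signed expansions are unique. The top quotient is lost with the factor
  \<open>m\<close>.\<close>

lemma shift_quotient_unique:
  assumes "b ^ q dvd m * (r - s * digit_val b q g)" "\<And>i. i < q \<Longrightarrow> \<bar>g i\<bar> < h"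
    and "b ^ q dvd m * (r - s * digit_val b q g')" "\<And>i. i < q \<Longrightarrow> \<bar>g' i\<bar> < h"
    and "i < q - 1"
  shows "g i = g' i"
proof -
  have "b ^ q dvd m * (r - s * digit_val b q g') - m * (r - s * digit_val b q g)"
    using assms by (blast intro: dvd_diff)
  then have "b ^ q dvd s * (m * (0 + 1 * digit_val b q (\<lambda>i. g i - g' i)))"
    by (simp add: digit_val_diff[symmetric] algebra_simps)
  then have "b ^ (q - 1) dvd digit_val b (q - 1) (\<lambda>i. g i - g' i)"
    using dvd_drop_top_digit[of 0 1] dvd_s_cancel by simp
  moreover have "\<bar>g i - g' i\<bar> < b" if "i < q - 1" for i
  proof -
    have "\<bar>g i - g' i\<bar> < 2 * h"
      using assms(2)[of i] assms(4)[of i] that by linarith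
    also have "\<dots> \<le> b"
      unfolding b_eq using m h by (intro mult_right_mono) auto
    finally show ?thesis .
  qed
  ultimately show ?thesis
    using digit_val_dvd_imp_0[of b "q - 1" "\<lambda>i. g i - g' i" i] b_pos assms(5) by simp
qed

lemma abs_eq_if_nontrivial_stabiliser:
  assumes small: "\<bar>r\<bar> + \<bar>s\<bar> < b ^ (q - 1)"
  shows "\<bar>r\<bar> = \<bar>s\<bar>"
proof -
  obtain d where "d \<in> D" using card_D by fastforce
  \<comment> \<open>The least member of the progression through \<open>d\<close>; the others are
    \<open>d0 + m * j\<close> with \<open>0 < j < h\<close>.\<close>
  define d0 where "d0 = d mod m"
  have d0_bounds: "0 \<le> d0" "d0 < m" using m by (auto simp: d0_def)
  have top: "d0 + m * j < b" if "j < h" for j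
  proof -
    have "m * (j + 1) \<le> m * h" using that m by (intro mult_left_mono) auto
    then show ?thesis using d0_bounds b_eq by (simp add: algebra_simps)
  qed
  have "d0 = d + m * (- (d div m))"
    by (simp add: d0_def minus_mult_div_eq_mod)
  then have d0: "d0 \<in> D"
    using digit_shift[OF \<open>d \<in> D\<close>, of "- (d div m)"] d0_bounds top[of 0] h by simp
  have d0_shift: "d0 + m * j \<in> D" if "0 \<le> j" "j < h" for j
    using digit_shift[OF d0] d0_bounds that m top by simp

  obtain w z where "match w z" using match_exists by blast
  then obtain z0 where z0: "match (w(0 := d0)) z0"
    using match_upd[of w z 0 d0] d0 q by (metis less_trans zero_less_one)
  then obtain z1 where "match ((w(0 := d0))(0 := d0 + m)) z1"
    using match_upd[of "w(0 := d0)" z0 0 "d0 + m"] d0_shift[of 1] q h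
    by (metis less_trans mult.right_neutral zero_less_one zero_le_one)
  then obtain g where g: "\<And>i. i < q \<Longrightarrow> \<bar>g i\<bar> < h"
      "b ^ q dvd m * (r - s * digit_val b q g)"
    using shift_quotient[OF z0] by (metis fun_upd_same)
  \<comment> \<open>By uniqueness, the quotients read off from one pair serve every pair.\<close>
  have step: "z' i = z i + m * g i"
    if pair: "match w z" "match (w(0 := w 0 + m)) z'" and "i < q - 1" for w z z' i
  proof -
    obtain g' where g': "\<And>i. i < q \<Longrightarrow> z' i - z i = m * g' i" "\<And>i. i < q \<Longrightarrow> \<bar>g' i\<bar> < h"
      "b ^ q dvd m * (r - s * digit_val b q g')"
      using shift_quotient[OF pair] by blast
    have "g' i = g i"
      using shift_quotient_unique[OF g'(3,2) g(2,1) that(3)] .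
    moreover have "i < q" using that(3) by simp
    ultimately show ?thesis using g'(1)[of i] by simp
  qed
  \<comment> \<open>The lowest digit walks up its progression, and each step adds the same
    \<open>m * g i\<close> to digit \<open>i\<close> of the partner.\<close>
  have progression: "\<exists>z'. match (w(0 := d0 + m * int j)) z' \<and> (\<forall>i<q - 1. z' i = z i + m * int j * g i)"
    if wz: "match w z" "w 0 = d0" and "int j < h" for w z j
    using that(3)
  proof (induction j)
    case 0
    have "w(0 := d0) = w" using wz(2) by auto
    then show ?case using wz(1) by auto
  next
    case (Suc j)
    then have "int j < h" by simp
    from Suc.IH[OF this]
    obtain z' where z': "match (w(0 := d0 + m * int j)) z'" "\<forall>i<q - 1. z' i = z i + m * int j * g i"
      by blast
    obtain z'' where z'': "match (w(0 := d0 + m * int (Suc j))) z''"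
      using match_upd[OF wz(1), of 0 "d0 + m * int (Suc j)"] d0_shift[of "int (Suc j)"] Suc.prems q
      by (metis less_trans of_nat_0_le_iff zero_less_one)
    have "z'' i = z' i + m * g i" if "i < q - 1" for i
      using step[OF z'(1) _ that, of z''] z'' by (simp add: algebra_simps)
    then have "\<forall>i<q - 1. z'' i = z i + m * int (Suc j) * g i"
      using z'(2) by (simp add: algebra_simps)
    with z'' show ?case by blast
  qed
  \<comment> \<open>The whole walk has \<open>h - 1\<close> steps, and the partner still consists of
    digits at its end.\<close>
  have last: "0 \<le> z i + m * (h - 1) * g i \<and> z i + m * (h - 1) * g i < b"
    if wz: "match w z" "w 0 = d0" and i: "i < q - 1" for w z i
  proof -
    have "int (nat (h - 1)) = h - 1" using h by simp
    then obtain z' where "match (w(0 := d0 + m * (h - 1))) z'" "z' i = z i + m * (h - 1) * g i"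
      using progression[OF wz, of "nat (h - 1)"] i by auto
    then show ?thesis using match_words(2) digit_bounds by metis
  qed
  have half: "b \<le> 2 * (m * (h - 1))"
  proof -
    have "m * h \<le> m * (2 * (h - 1))" using m h by (intro mult_left_mono) auto
    then show ?thesis using b_eq by (simp add: algebra_simps)
  qed
  have mh: "0 \<le> m * (h - 1)" using m h by simp

  \<comment> \<open>If \<open>\<bar>g 0\<bar>\<close> were at least 2, the walk would move digit 0
    by at least \<open>b\<close>, by \<open>half\<close>.\<close>
  have g0: "\<bar>g 0\<bar> \<le> 1"
  proof (rule ccontr)
    assume "\<not> \<bar>g 0\<bar> \<le> 1"
    then have "2 * (m * (h - 1)) \<le> \<bar>g 0\<bar> * (m * (h - 1))"
      using mh by (intro mult_right_mono) auto
    also have "\<dots> = \<bar>m * (h - 1) * g 0\<bar>"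
      using m h by (simp add: abs_mult)
    also have "\<dots> < b"
      using last[OF z0, of 0] q digit_bounds[OF match_words(2)[OF z0, of 0]] by auto
    finally show False using half by simp
  qed
  have g_zero: "g i = 0" if i: "0 < i" "i < q - 1" for i
  proof (rule ccontr)
    have "i < q" using i by simp
    assume "g i \<noteq> 0"
    then consider "g i \<ge> 1" | "g i \<le> -1" by linarith
    then show False
    proof cases
      case 1
      \<comment> \<open>As \<open>i > 0\<close>, digit \<open>i\<close> of the word can be chosen
        while digit 0 stays \<open>d0\<close>. It is chosen so that the partner digit starts at the
        top of its progression, leaving no room upwards.\<close>
      have "d0 + m * (h - 1) \<in> D"
        using d0_shift[of "h - 1"] h by simp
      then obtain d' z' where z': "match ((w(0 := d0))(i := d')) z'" "z' i = d0 + m * (h - 1)"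
        using match_hit_digit[OF z0 \<open>i < q\<close>] by metis
      have "m * (h - 1) * 1 \<le> m * (h - 1) * g i"
        using 1 mh by (rule mult_left_mono)
      moreover have "z' i + m * (h - 1) * g i < b"
        using last[OF z'(1) _ i(2)] i by simp
      ultimately show False
        unfolding z'(2) mult_1_right using half d0_bounds by linarith
    next
      case 2
      \<comment> \<open>Symmetrically, the partner digit starts at the bottom, below
        \<open>m\<close>, leaving no room downwards.\<close>
      obtain d' z' where z': "match ((w(0 := d0))(i := d')) z'" "z' i = d0"
        using match_hit_digit[OF z0 \<open>i < q\<close> d0] by metis
      have "m * (h - 1) * g i \<le> m * (h - 1) * (- 1)"
        using 2 mh by (rule mult_left_mono)
      moreover have "m * 1 \<le> m * (h - 1)"
        using m h by (intro mult_left_mono) auto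
      moreover have "0 \<le> z' i + m * (h - 1) * g i"
        using last[OF z'(1) _ i(2)] i by simp
      ultimately show False
        unfolding z'(2) mult_minus_right mult_1_right using d0_bounds by linarith
    qed
  qed
  \<comment> \<open>The top quotient is dropped and the middle ones vanish, so only
    \<open>g 0\<close> remains.\<close>
  have "b ^ (q - 1) dvd r + (- s) * digit_val b (q - 1) g"
    using g(2) by (intro dvd_drop_top_digit) simp
  also have "digit_val b (q - 1) g = g 0"
    using q g_zero by (intro digit_val_single) auto
  finally have "b ^ (q - 1) dvd r - s * g 0" by simp
  moreover have "\<bar>r - s * g 0\<bar> < b ^ (q - 1)"
  proof -
    have "\<bar>s * g 0\<bar> \<le> \<bar>s\<bar>"
      using g0 mult_left_mono[of "\<bar>g 0\<bar>" 1 "\<bar>s\<bar>"] by (simp add: abs_mult)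
    then show ?thesis using small by linarith
  qed
  ultimately have r_eq: "r = s * g 0"
    using int_dvd_abs_less_imp_0 by fastforce
  have "r \<noteq> 0"
    using coprime_r card_D by auto
  then have "\<bar>g 0\<bar> = 1" using g0 r_eq by (cases "g 0 = 0") auto
  then show ?thesis by (simp add: r_eq abs_mult)
qed

end

end

lemma (in digit_pair) missing_word:
  assumes "\<bar>r\<bar> \<noteq> \<bar>s\<bar>" and small: "\<bar>r\<bar> + \<bar>s\<bar> < b ^ (q - 1)"
  shows "\<exists>w\<in>words. \<forall>z\<in>words. \<not> b ^ q dvd r * digit_val b q w - s * digit_val b q z - k"
proof (rule ccontr)
  assume "\<not> ?thesis"
  then interpret saturated_digit_pair b r s D q k
    by unfold_locales blast
  \<comment> \<open>For \<open>q \<le> 1\<close> the exponent \<open>q - 1\<close> is 0, and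
    \<open>small\<close> would force \<open>r = s = 0\<close>.\<close>
  have q: "q > 1"
  proof (rule ccontr)
    assume "\<not> q > 1"
    then have "\<bar>r\<bar> + \<bar>s\<bar> < 1" using small by simp
    then show False using assms(1) by linarith
  qed
  obtain m where m: "m > 1" "m dvd b" "\<And>g. g \<in> stabiliser \<longleftrightarrow> m dvd g"
    using stabiliser_generator by blast
  obtain h where h: "b = m * h" using m(2) by blast
  then have "h > 0" using b_pos m(1) by (simp add: zero_less_mult_iff)
  then have "m = b \<or> h > 1" using h by (cases "h = 1") auto
  then show False
    using abs_eq_if_trivial_stabiliser abs_eq_if_nontrivial_stabiliser[OF m(3,1) _ h q] m q small assms(1)
    by auto
qed

section \<open>Counting solvable prefixes\<close>

context digit_pair
begin

definition digit_ints :: "nat \<Rightarrow> int set" where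
  "digit_ints n = digit_val b n ` words"

lemma digit_ints_0: "digit_ints 0 \<subseteq> {0}"
  by (auto simp: digit_ints_def)

lemma digit_ints_bounds: "u \<in> digit_ints n \<Longrightarrow> 0 \<le> u \<and> u < b ^ n"
proof (unfold digit_ints_def, elim imageE, hypsubst)
  fix w assume "w \<in> words"
  show "0 \<le> digit_val b n w \<and> digit_val b n w < b ^ n"
  proof (induction n)
    case (Suc n)
    have "0 \<le> w n" "w n \<le> b - 1"
      using digit_bounds[OF wordsD[OF \<open>w \<in> words\<close>], of n] by auto
    then have "0 \<le> b ^ n * w n" "b ^ n * w n \<le> b ^ n * (b - 1)"
      using b_pos by (auto intro!: mult_left_mono)
    then show ?case using Suc by (simp add: digit_val_Suc algebra_simps)
  qed simp
qed

lemma digit_ints_add: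
  assumes "u \<in> digit_ints (m + n)"
  obtains u1 u2 where "u1 \<in> digit_ints m" "u2 \<in> digit_ints n" "u = u1 + b ^ m * u2"
proof -
  obtain w where w: "w \<in> words" "u = digit_val b (m + n) w"
    using assms by (auto simp: digit_ints_def)
  then have "(\<lambda>i. w (m + i)) \<in> words" by (simp add: words_def)
  then show thesis
    using that[of "digit_val b m w" "digit_val b n (\<lambda>i. w (m + i))"] w
    by (simp add: digit_ints_def digit_val_add)
qed

lemma digit_ints_Suc_subset: "digit_ints (Suc n) \<subseteq> (\<lambda>(u, d). u + b ^ n * d) ` (digit_ints n \<times> D)"
  by (auto simp: digit_ints_def digit_val_Suc dest: wordsD)

lemma finite_digit_ints: "finite (digit_ints n)"
proof (rule finite_subset)
  show "digit_ints n \<subseteq> {0..b ^ n}"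
    using digit_ints_bounds by fastforce
qed simp

lemma card_digit_ints: "card (digit_ints n) \<le> card D ^ n"
proof (induction n)
  case 0
  then show ?case using card_mono[OF _ digit_ints_0] by simp
next
  case (Suc n)
  have "card (digit_ints (Suc n)) \<le> card ((\<lambda>(u, d). u + b ^ n * d) ` (digit_ints n \<times> D))"
    using finite_digit_ints finite_D by (intro card_mono digit_ints_Suc_subset) auto
  also have "\<dots> \<le> card (digit_ints n \<times> D)"
    using finite_digit_ints finite_D by (intro card_image_le) auto
  also have "\<dots> \<le> card D ^ Suc n"
    using Suc by (simp add: card_cartesian_product)
  finally show ?case .
qed

text \<open>The parameter \<open>t\<close> is the required value of \<open>r * u - s * v\<close>
  modulo \<open>b ^ n\<close>; after a block has been read, it is the carry into the next
  one.\<close>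

definition solvable :: "nat \<Rightarrow> int \<Rightarrow> int set" where
  "solvable n t = {u \<in> digit_ints n. \<exists>v\<in>digit_ints n. b ^ n dvd r * u - s * v - t}"

lemma finite_solvable: "finite (solvable n t)"
  using finite_digit_ints by (simp add: solvable_def)

lemma card_solvable:
  assumes "\<bar>r\<bar> \<noteq> \<bar>s\<bar>" "\<bar>r\<bar> + \<bar>s\<bar> < b ^ (q - 1)"
  shows "card (solvable q t) \<le> card D ^ q - 1"
proof -
  obtain w where w: "w \<in> words" "\<forall>z\<in>words. \<not> b ^ q dvd r * digit_val b q w - s * digit_val b q z - t"
    using missing_word[OF assms] by blast
  then have sub: "solvable q t \<subseteq> digit_ints q - {digit_val b q w}"
    by (auto simp: solvable_def digit_ints_def)
  have "digit_val b q w \<in> digit_ints q"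
    using w(1) by (simp add: digit_ints_def)
  then have "card (solvable q t) \<le> card (digit_ints q) - 1"
    using card_mono[OF _ sub] finite_digit_ints by simp
  then show ?thesis using card_digit_ints[of q] by linarith
qed

text \<open>The lowest block of a solvable prefix is solvable for \<open>t\<close>. It determines
  the partner block, hence the next carry \<open>c u\<close>, for which the remaining blocks are
  solvable. The induction therefore runs over all \<open>t\<close>.\<close>

lemma card_solvable_mult:
  assumes "\<bar>r\<bar> \<noteq> \<bar>s\<bar>" "\<bar>r\<bar> + \<bar>s\<bar> < b ^ (q - 1)"
  shows "card (solvable (q * n) t) \<le> (card D ^ q - 1) ^ n"
proof (induction n arbitrary: t)
  case 0
  have "solvable (q * 0) t \<subseteq> {0}"
    using digit_ints_0 by (auto simp: solvable_def)
  then have "card (solvable (q * 0) t) \<le> card {0 :: int}"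
    by (intro card_mono) auto
  then show ?case by simp
next
  case (Suc n)
  obtain f where f: "\<And>u. u \<in> solvable q t \<Longrightarrow> f u \<in> digit_ints q \<and> b ^ q dvd r * u - s * f u - t"
  proof -
    have "\<forall>u\<in>solvable q t. \<exists>v. v \<in> digit_ints q \<and> b ^ q dvd r * u - s * v - t"
      by (auto simp: solvable_def)
    then show thesis using that by metis
  qed
  \<comment> \<open>The carry after the block \<open>u\<close> and its partner \<open>f u\<close>;
    the division is exact for solvable \<open>u\<close>.\<close>
  define c where "c u = (t - r * u + s * f u) div b ^ q" for u
  have c: "r * u - s * f u - t = b ^ q * (- c u)" if "u \<in> solvable q t" for u
  proof -
    have "b ^ q dvd - (r * u - s * f u - t)"
      using f[OF that] dvd_minus_iff by blast
    then have "b ^ q dvd t - r * u + s * f u"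
      by (simp add: algebra_simps)
    then show ?thesis by (simp add: c_def)
  qed
  have "solvable (q * Suc n) t \<subseteq> (\<Union>u\<in>solvable q t. (\<lambda>u'. u + b ^ q * u') ` solvable (q * n) (c u))"
  proof
    fix x assume "x \<in> solvable (q * Suc n) t"
    then obtain y where x: "x \<in> digit_ints (q + q * n)" and y: "y \<in> digit_ints (q + q * n)"
      and dvd: "b ^ (q + q * n) dvd r * x - s * y - t"
      by (auto simp: solvable_def)
    obtain u u' where u: "u \<in> digit_ints q" "u' \<in> digit_ints (q * n)" "x = u + b ^ q * u'"
      using digit_ints_add[OF x] .
    obtain v v' where v: "v \<in> digit_ints q" "v' \<in> digit_ints (q * n)" "y = v + b ^ q * v'"
      using digit_ints_add[OF y] .
    have eq: "r * x - s * y - t = (r * u - s * v - t) + b ^ q * (r * u' - s * v')"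
      by (simp add: u v algebra_simps)
    have "b ^ q dvd r * x - s * y - t"
      using dvd by (metis dvd_mult_left power_add)
    then have dvd_q: "b ^ q dvd r * u - s * v - t"
      unfolding eq by (metis dvd_add_left_iff dvd_triv_left)
    then have u_sol: "u \<in> solvable q t"
      using u v by (auto simp: solvable_def)
    then have "b ^ q dvd (r * u - s * f u - t) - (r * u - s * v - t)"
      using f dvd_q by (blast intro: dvd_diff)
    then have "b ^ q dvd s * (v - f u)" by (simp add: algebra_simps)
    then have "b ^ q dvd v - f u" using dvd_s_cancel by simp
    moreover have "\<bar>v - f u\<bar> < b ^ q"
      using digit_ints_bounds[OF v(1)] digit_ints_bounds[of "f u" q] f[OF u_sol] by auto
    \<comment> \<open>The partner block is unique: \<open>s\<close> is invertible and both
      candidates lie below \<open>b ^ q\<close>.\<close>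
    ultimately have "v = f u" using int_dvd_abs_less_imp_0 by fastforce
    then have "r * x - s * y - t = b ^ q * (r * u' - s * v' - c u)"
      using eq c[OF u_sol] by (simp add: algebra_simps)
    then have "b ^ q * b ^ (q * n) dvd b ^ q * (r * u' - s * v' - c u)"
      using dvd by (simp add: power_add)
    then have "b ^ (q * n) dvd r * u' - s * v' - c u"
      using b_pos by simp
    then have "u' \<in> solvable (q * n) (c u)"
      using u v by (auto simp: solvable_def)
    then show "x \<in> (\<Union>u\<in>solvable q t. (\<lambda>u'. u + b ^ q * u') ` solvable (q * n) (c u))"
      using u u_sol by blast
  qed
  then have "card (solvable (q * Suc n) t)
      \<le> card (\<Union>u\<in>solvable q t. (\<lambda>u'. u + b ^ q * u') ` solvable (q * n) (c u))"
    by (intro card_mono) (auto simp: finite_solvable)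
  also have "\<dots> \<le> (\<Sum>u\<in>solvable q t. card ((\<lambda>u'. u + b ^ q * u') ` solvable (q * n) (c u)))"
    by (intro card_UN_le finite_solvable)
  also have "\<dots> \<le> (\<Sum>u\<in>solvable q t. (card D ^ q - 1) ^ n)"
    using Suc finite_solvable by (intro sum_mono) (meson card_image_le le_trans)
  also have "\<dots> = card (solvable q t) * (card D ^ q - 1) ^ n" by simp
  also have "\<dots> \<le> (card D ^ q - 1) ^ Suc n"
    using card_solvable[OF assms] by simp
  finally show ?case .
qed

text \<open>Only the lowest \<open>q * n\<close> digits are constrained, through the equation modulo
  \<open>b ^ (q * n)\<close>; the \<open>L\<close> upper digits of \<open>X\<close> are counted
  freely. \<open>L'\<close> may differ from \<open>L\<close>, to absorb the power of
  \<open>b\<close> in the scaling factor.\<close>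

lemma ex_prefixes:
  assumes "\<bar>r\<bar> \<noteq> \<bar>s\<bar>" "\<bar>r\<bar> + \<bar>s\<bar> < b ^ (q - 1)" and "finite T"
  shows "\<exists>P. finite P \<and> card P \<le> card T * (card D ^ q - 1) ^ n * card D ^ L \<and>
     (\<forall>X\<in>digit_ints (q * n + L). \<forall>Y\<in>digit_ints (q * n + L'). r * X - s * Y \<in> T \<longrightarrow> X \<in> P)"
proof -
  define U where "U = (\<Union>t\<in>T. solvable (q * n) t)"
  have finU: "finite U" using assms(3) finite_solvable by (simp add: U_def)
  define P where "P = (\<lambda>(u, v). u + b ^ (q * n) * v) ` (U \<times> digit_ints L)"
  have "card P \<le> card (U \<times> digit_ints L)"
    unfolding P_def using finU finite_digit_ints by (intro card_image_le) auto
  also have "\<dots> = card U * card (digit_ints L)" by (rule card_cartesian_product)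
  also have "\<dots> \<le> (card T * (card D ^ q - 1) ^ n) * card D ^ L"
  proof (rule mult_mono)
    have "card U \<le> (\<Sum>t\<in>T. card (solvable (q * n) t))"
      unfolding U_def by (intro card_UN_le assms(3))
    also have "\<dots> \<le> (\<Sum>t\<in>T. (card D ^ q - 1) ^ n)"
      by (intro sum_mono card_solvable_mult assms)
    finally show "card U \<le> card T * (card D ^ q - 1) ^ n" by simp
  qed (use card_digit_ints in auto)
  finally have "card P \<le> card T * (card D ^ q - 1) ^ n * card D ^ L" .
  moreover have "finite P" unfolding P_def using finU finite_digit_ints by simp
  moreover have "X \<in> P"
    if X: "X \<in> digit_ints (q * n + L)" and Y: "Y \<in> digit_ints (q * n + L')" and t: "r * X - s * Y \<in> T" for X Y
  proof -
    obtain u u' where u: "u \<in> digit_ints (q * n)" "u' \<in> digit_ints L" "X = u + b ^ (q * n) * u'"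
      using digit_ints_add[OF X] .
    obtain v v' where v: "v \<in> digit_ints (q * n)" "v' \<in> digit_ints L'" "Y = v + b ^ (q * n) * v'"
      using digit_ints_add[OF Y] .
    have "r * u - s * v - (r * X - s * Y) = b ^ (q * n) * (s * v' - r * u')"
      by (simp add: u v algebra_simps)
    then have "b ^ (q * n) dvd r * u - s * v - (r * X - s * Y)"
      by (rule dvdI)
    then have "u \<in> solvable (q * n) (r * X - s * Y)"
      using u(1) v(1) unfolding solvable_def by blast
    then have "u \<in> U" using t by (auto simp: U_def)
    then show ?thesis using u by (auto simp: P_def)
  qed
  ultimately show ?thesis by blast
qed

end

section \<open>Missing-digit sets and their intersections\<close>

lemma missing_digit_set_props:
  assumes "b \<ge> 2" "D \<subseteq> {0..<b}" "x \<in> missing_digit_set b D"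
  shows missing_digit_set_bounds: "0 \<le> x" "x \<le> 1"
    and missing_digit_set_shift: "\<exists>d\<in>D. \<exists>y\<in>missing_digit_set b D. real b * x = real d + y"
proof -
  obtain \<epsilon> where x: "x = (\<Sum>j. real (\<epsilon> j) / real b ^ Suc j)" and \<epsilon>: "\<And>j. \<epsilon> j \<in> D"
    using assms(3) by (auto simp: missing_digit_set_def)
  have b: "real b > 1" using assms(1) by simp
  \<comment> \<open>The series with all digits equal to \<open>b - 1\<close> dominates every
    expansion.\<close>
  have geom: "(\<lambda>j. (real b - 1) / real b ^ Suc j) sums 1"
  proof -
    have "(\<lambda>j. (1 / real b) ^ j) sums (1 / (1 - 1 / real b))"
      using b by (intro geometric_sums) simp
    then have "(\<lambda>j. ((real b - 1) / real b) * (1 / real b) ^ j) sums ((real b - 1) / real b * (1 / (1 - 1 / real b)))"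
      by (rule sums_mult)
    then show ?thesis using b by (simp add: power_divide divide_simps)
  qed
  have le: "real (e j) / real b ^ Suc j \<le> (real b - 1) / real b ^ Suc j" if "\<And>j. e j \<in> D" for e :: "nat \<Rightarrow> nat" and j
  proof -
    have "e j < b" using that[of j] assms(2) by auto
    then show ?thesis using b by (intro divide_right_mono) auto
  qed
  have summable: "summable (\<lambda>j. real (e j) / real b ^ Suc j)" if "\<And>j. e j \<in> D" for e :: "nat \<Rightarrow> nat"
  proof (rule summable_comparison_test')
    show "summable (\<lambda>j. (real b - 1) / real b ^ Suc j)"
      using geom sums_summable by blast
    show "norm (real (e j) / real b ^ Suc j) \<le> (real b - 1) / real b ^ Suc j" for j
      using le[of e j] that by (simp del: power_Suc)
  qed
  show "0 \<le> x"
    unfolding x by (intro suminf_nonneg summable \<epsilon>) simp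
  have "x \<le> (\<Sum>j. (real b - 1) / real b ^ Suc j)"
    unfolding x using geom sums_summable by (intro suminf_le le summable \<epsilon>) blast
  then show "x \<le> 1" using geom sums_unique by metis
  define y where "y = (\<Sum>j. real (\<epsilon> (Suc j)) / real b ^ Suc j)"
  have "(\<Sum>j. real (\<epsilon> (Suc j)) / real b ^ Suc (Suc j)) = x - real (\<epsilon> 0) / real b"
    unfolding x using suminf_split_head[OF summable[OF \<epsilon>]] by simp
  moreover have "real b * (\<Sum>j. real (\<epsilon> (Suc j)) / real b ^ Suc (Suc j)) = y"
    unfolding y_def
    using summable_Suc_iff[of "\<lambda>j. real (\<epsilon> j) / real b ^ Suc j"] summable[OF \<epsilon>] b
    by (subst suminf_mult[symmetric]) (simp_all add: field_simps)
  ultimately have "y = real b * (x - real (\<epsilon> 0) / real b)"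
    by (simp only:)
  then have "real b * x = real (\<epsilon> 0) + y"
    using b by (simp add: right_diff_distrib)
  moreover have "y \<in> missing_digit_set b D"
    using \<epsilon> by (auto simp: missing_digit_set_def y_def)
  ultimately show "\<exists>d\<in>D. \<exists>y\<in>missing_digit_set b D. real b * x = real d + y"
    using \<epsilon> by blast
qed

section \<open>Covering numbers and upper Minkowski dimension\<close>

lemma interval_covering_number_le:
  assumes "finite C" "A \<subseteq> (\<Union>c\<in>C. {c..c + \<delta>})"
  shows "interval_covering_number \<delta> A \<le> card C"
  unfolding interval_covering_number_def using assms by (intro Least_le) blast

text \<open>With \<open>n\<close> about \<open>- ln \<delta> / ln B\<close>, rounding and the
  constant \<open>c\<close> contribute a bounded error to the logarithm, which vanishes after
  division by \<open>- ln \<delta>\<close>.\<close>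

lemma upper_minkowski_dim_le:
  assumes "B > 1" "a \<ge> 1" "c \<ge> 1"
    and cover: "\<And>\<delta> n. 1 / B ^ n \<le> \<delta> \<Longrightarrow> real (interval_covering_number \<delta> A) \<le> c * a ^ n"
  shows "upper_minkowski_dim A \<le> ereal (ln a / ln B)"
proof (cases "A = {}")
  case True
  then show ?thesis using assms by (simp add: upper_minkowski_dim_def)
next
  case False
  define F where "F \<delta> = (ln c + ln a) / (- ln \<delta>) + ln a / ln B" for \<delta>
  have lnB: "ln B > 0" and lna: "ln a \<ge> 0" and lnc: "ln c \<ge> 0"
    using assms by auto
  have bound: "ln (real (interval_covering_number \<delta> A)) / (- ln \<delta>) \<le> F \<delta>" if \<delta>: "0 < \<delta>" "\<delta> < 1" for \<delta>
  proof -
    have neg: "- ln \<delta> > 0" using \<delta> by simp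
    \<comment> \<open>The least \<open>n\<close> for which
      \<open>1 / B ^ n \<le> \<delta>\<close>.\<close>
    define n where "n = nat \<lceil>- ln \<delta> / ln B\<rceil>"
    have n: "- ln \<delta> / ln B \<le> real n" "real n \<le> - ln \<delta> / ln B + 1"
      using neg lnB ceiling_correct[of "- ln \<delta> / ln B"] by (simp_all add: n_def)
    have "- ln \<delta> \<le> ln (B ^ n)"
      using n(1) lnB assms(1) by (simp add: ln_realpow field_simps)
    then have "ln (1 / B ^ n) \<le> ln \<delta>"
      using assms(1) by (simp add: ln_div)
    then have "1 / B ^ n \<le> \<delta>"
      using \<delta> assms(1) by simp
    then have le: "real (interval_covering_number \<delta> A) \<le> c * a ^ n"
      by (rule cover)
    have "ln (real (interval_covering_number \<delta> A)) \<le> ln (c * a ^ n)"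
    \<comment> \<open>As \<open>ln 0 = 0\<close>, the value 0 only requires the right-hand side to
      be nonnegative.\<close>
    proof (cases "interval_covering_number \<delta> A = 0")
      case True
      have "1 \<le> c * a ^ n"
        using assms mult_mono[of 1 c 1 "a ^ n"] one_le_power[of a n] by simp
      then show ?thesis using True by simp
    next
      case False
      then show ?thesis using le by (intro ln_mono) auto
    qed
    also have "\<dots> = ln c + real n * ln a"
      using assms by (simp add: ln_mult ln_realpow)
    also have "\<dots> \<le> ln c + (- ln \<delta> / ln B + 1) * ln a"
      using n(2) lna by (intro add_left_mono mult_right_mono)
    also have "\<dots> = F \<delta> * (- ln \<delta>)"
      using neg lnB by (simp add: F_def field_simps)
    finally show ?thesis
      using neg by (simp only: pos_divide_le_eq)
  qed
  have "filterlim (\<lambda>\<delta>::real. - ln \<delta>) at_top (at_right 0)"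
    using ln_at_0 by (simp add: filterlim_uminus_at_top)
  then have "((\<lambda>\<delta>. (ln c + ln a) / (- ln \<delta>)) \<longlongrightarrow> 0) (at_right 0)"
    by (rule tendsto_divide_0[OF tendsto_const filterlim_at_top_imp_at_infinity])
  then have "(F \<longlongrightarrow> 0 + ln a / ln B) (at_right 0)"
    unfolding F_def by (intro tendsto_add tendsto_const)
  then have lim: "((\<lambda>\<delta>. ereal (F \<delta>)) \<longlongrightarrow> ereal (ln a / ln B)) (at_right 0)"
    by simp
  have "\<forall>\<^sub>F \<delta> in at_right 0. ereal (ln (real (interval_covering_number \<delta> A)) / (- ln \<delta>)) \<le> ereal (F \<delta>)"
    unfolding eventually_at_right_field by (intro exI[of _ 1]) (simp add: bound del: divide_minus_right)
  then have "upper_minkowski_dim A \<le> Limsup (at_right 0) (\<lambda>\<delta>. ereal (F \<delta>))"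
    using False by (simp add: upper_minkowski_dim_def Limsup_mono del: divide_minus_right)
  also have "\<dots> = ereal (ln a / ln B)"
    using lim by (intro lim_imp_Limsup) simp_all
  finally show ?thesis .
qed

lemma missing_digit_set_prefix:
  assumes "digit_pair (int b) r s (int ` D)" "b \<ge> 2" "D \<subseteq> {0..<b}" "x \<in> missing_digit_set b D"
  shows "\<exists>X\<in>digit_pair.digit_ints (int b) (int ` D) n. \<exists>y\<in>missing_digit_set b D.
    real b ^ n * x = real_of_int X + y"
proof -
  interpret digit_pair "int b" r s "int ` D" by fact
  have "\<exists>w\<in>words. \<exists>y\<in>missing_digit_set b D. real b ^ n * x = real_of_int (digit_val (int b) n w) + y"
    using assms(4)
  proof (induction n arbitrary: x)
    case 0
    obtain d where "d \<in> int ` D" using card_D by fastforce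
    then have "(\<lambda>_. d) \<in> words" by (simp add: words_def)
    then show ?case using 0 by auto
  next
    case (Suc n)
    obtain d y where d: "d \<in> D" "y \<in> missing_digit_set b D" "real b * x = real d + y"
      using missing_digit_set_shift[OF assms(2,3) Suc.prems] by blast
    obtain w z where w: "w \<in> words" "z \<in> missing_digit_set b D"
      "real b ^ n * y = real_of_int (digit_val (int b) n w) + z"
      using Suc.IH[OF d(2)] by blast
    \<comment> \<open>The first digit after the radix point is the most significant one, so it
      enters the word at index \<open>n\<close>.\<close>
    have "digit_val (int b) (Suc n) (w(n := int d)) = digit_val (int b) n w + int b ^ n * int d"
      using digit_val_cong[of n "w(n := int d)" w "int b"] by (simp add: digit_val_Suc)
    moreover have "real b ^ Suc n * x = real b ^ n * (real d + y)"
      using d(3) by (simp add: mult.assoc mult.left_commute)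
    ultimately have "real b ^ Suc n * x = real_of_int (digit_val (int b) (Suc n) (w(n := int d))) + z"
      using w(3) by (simp add: algebra_simps)
    moreover have "w(n := int d) \<in> words"
      using words_upd[OF w(1)] d(1) by blast
    ultimately show ?case using w(2) by blast
  qed
  then show ?thesis by (auto simp: digit_ints_def)
qed

text \<open>Multiplying \<open>z = \<gamma> * y + \<alpha>\<close> by \<open>r * b ^ n\<close> and
  splitting off the tails in \<open>[0, 1]\<close> confines \<open>r * X - s * Y\<close> to
  boundedly many integers. Each admissible prefix \<open>X\<close> contributes one interval.\<close>

lemma intersection_covering_number_le:
  fixes b r q :: nat and D :: "nat set" and s l :: int and \<gamma> \<alpha> :: real
  assumes pair: "digit_pair (int b) (int r) s (int ` D)"
    and b: "b \<ge> 2" and D: "D \<subseteq> {0..<b}" and r: "r \<ge> 1" and "\<bar>s\<bar> \<noteq> int r"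
    and small: "int r + \<bar>s\<bar> < int b ^ (q - 1)"
    and \<gamma>: "\<gamma> = real_of_int s / real r * real b powi l"
    and \<delta>: "1 / real b ^ (q * k) \<le> \<delta>"
  shows "interval_covering_number \<delta> ((\<lambda>x. \<gamma> * x + \<alpha>) ` missing_digit_set b D \<inter> missing_digit_set b D)
    \<le> (2 * (nat \<bar>s\<bar> + r) + 2) * card D ^ nat \<bar>l\<bar> * (card D ^ q - 1) ^ k"
proof -
  interpret digit_pair "int b" "int r" s "int ` D" by fact
  let ?K = "missing_digit_set b D"
  \<comment> \<open>\<open>L'\<close> is nonnegative and gives \<open>m = n + l\<close>, so
    \<open>b ^ n * b powi l = b ^ m\<close>, while both lengths are at least
    \<open>q * k\<close>.\<close>
  define L L' where "L = nat \<bar>l\<bar>" and "L' = nat (\<bar>l\<bar> + l)"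
  define n m where "n = q * k + L" and "m = q * k + L'"
  define \<beta> where "\<beta> = real r * \<alpha> * real b ^ n"
  define R where "R = int r + \<bar>s\<bar>"
  \<comment> \<open>All integers within \<open>R\<close> of \<open>\<beta>\<close> lie in
    \<open>T\<close>; the extra 1 makes up for the floor.\<close>
  define T where "T = {\<lfloor>\<beta>\<rfloor> - R .. \<lfloor>\<beta>\<rfloor> + R + 1}"
  have bn: "real b ^ n > 0" using b by simp
  have powi: "real b ^ n * real b powi l = real b ^ m"
  proof -
    have "real b powi (int n) * real b powi l = real b powi (int n + l)"
      using b by (subst power_int_add) auto
    also have "int n + l = int m"
      by (simp add: n_def m_def L_def L'_def)
    finally show ?thesis by simp
  qed
  have cardD: "card (int ` D) = card D" by (simp add: card_image)
  have "card T = 2 * (nat \<bar>s\<bar> + r) + 2"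
    by (simp add: T_def R_def nat_add_distrib nat_mult_distrib)
  then obtain P where P: "finite P"
      "card P \<le> (2 * (nat \<bar>s\<bar> + r) + 2) * (card D ^ q - 1) ^ k * card D ^ L"
      "\<And>X Y. X \<in> digit_ints n \<Longrightarrow> Y \<in> digit_ints m \<Longrightarrow> int r * X - s * Y \<in> T \<Longrightarrow> X \<in> P"
    using ex_prefixes[of q T k L L'] assms(5) small unfolding n_def m_def cardD
    by (auto simp: T_def)
  define C where "C = (\<lambda>X. real_of_int X / real b ^ n) ` P"
  have "(\<lambda>x. \<gamma> * x + \<alpha>) ` ?K \<inter> ?K \<subseteq> (\<Union>c\<in>C. {c..c + \<delta>})"
  proof
    fix z assume "z \<in> (\<lambda>x. \<gamma> * x + \<alpha>) ` ?K \<inter> ?K"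
    then obtain y where y: "y \<in> ?K" "z = \<gamma> * y + \<alpha>" and z: "z \<in> ?K" by blast
    obtain X z' where X: "X \<in> digit_ints n" "z' \<in> ?K" "real b ^ n * z = real_of_int X + z'"
      using missing_digit_set_prefix[OF pair b D z] by blast
    obtain Y y' where Y: "Y \<in> digit_ints m" "y' \<in> ?K" "real b ^ m * y = real_of_int Y + y'"
      using missing_digit_set_prefix[OF pair b D y(1)] by blast
    have z': "0 \<le> z'" "z' \<le> 1" and y': "0 \<le> y'" "y' \<le> 1"
      using missing_digit_set_bounds[OF b D] X(2) Y(2) by auto
    have "real r * (real b ^ n * z) = real_of_int s * (real b ^ n * real b powi l) * y + \<beta>"
      using r by (simp add: y(2) \<gamma> \<beta>_def field_simps)
    then have "real r * (real_of_int X + z') = real_of_int s * (real_of_int Y + y') + \<beta>"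
      unfolding powi X(3) Y(3)[symmetric] by simp
    then have "real_of_int (int r * X - s * Y) - \<beta> = real_of_int s * y' - real r * z'"
      by (simp add: algebra_simps)
    moreover have "\<bar>real_of_int s * y' - real r * z'\<bar> \<le> real_of_int R"
    proof -
      have "\<bar>real_of_int s * y' - real r * z'\<bar> \<le> \<bar>real_of_int s\<bar> * \<bar>y'\<bar> + \<bar>real r\<bar> * \<bar>z'\<bar>"
        by (metis abs_mult abs_triangle_ineq4)
      also have "\<dots> \<le> \<bar>real_of_int s\<bar> * 1 + \<bar>real r\<bar> * 1"
        using y' z' by (intro add_mono mult_left_mono) auto
      finally show ?thesis by (simp add: R_def)
    qed
    ultimately have "\<bar>real_of_int (int r * X - s * Y) - \<beta>\<bar> \<le> real_of_int R" by simp
    then have "int r * X - s * Y \<in> T"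
    proof -
      assume le: "\<bar>real_of_int (int r * X - s * Y) - \<beta>\<bar> \<le> real_of_int R"
      have "real_of_int \<lfloor>\<beta>\<rfloor> \<le> \<beta>" "\<beta> < real_of_int \<lfloor>\<beta>\<rfloor> + 1" by linarith+
      then have "real_of_int (\<lfloor>\<beta>\<rfloor> - R) \<le> real_of_int (int r * X - s * Y)"
        "real_of_int (int r * X - s * Y) \<le> real_of_int (\<lfloor>\<beta>\<rfloor> + R + 1)"
        using le unfolding of_int_add of_int_diff of_int_1 by linarith+
      then show ?thesis unfolding T_def of_int_le_iff by simp
    qed
    then have "X \<in> P" using P(3) X(1) Y(1) by blast
    \<comment> \<open>The tail contributes at most \<open>1 / b ^ n\<close>, which is at most
      \<delta>.\<close>
    moreover have "z \<in> {real_of_int X / real b ^ n .. real_of_int X / real b ^ n + \<delta>}"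
    proof -
      have "z = real_of_int X / real b ^ n + z' / real b ^ n"
        using X(3) bn by (simp add: field_simps)
      moreover have "z' / real b ^ n \<le> 1 / real b ^ n"
        using z' bn by (intro divide_right_mono) auto
      moreover have "1 / real b ^ n \<le> 1 / real b ^ (q * k)"
        using b by (intro divide_left_mono power_increasing) (auto simp: n_def)
      moreover have "0 \<le> z' / real b ^ n" using z' bn by simp
      ultimately show ?thesis using \<delta> by auto
    qed
    ultimately show "z \<in> (\<Union>c\<in>C. {c..c + \<delta>})" by (auto simp: C_def)
  qed
  then have "interval_covering_number \<delta> ((\<lambda>x. \<gamma> * x + \<alpha>) ` ?K \<inter> ?K) \<le> card C"
    using P(1) by (intro interval_covering_number_le) (auto simp: C_def)
  also have "card C \<le> card P"
    unfolding C_def by (rule card_image_le[OF P(1)])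
  also have "card P \<le> (2 * (nat \<bar>s\<bar> + r) + 2) * card D ^ nat \<bar>l\<bar> * (card D ^ q - 1) ^ k"
    using P(2) by (simp only: L_def mult.assoc mult.left_commute mult.commute)
  finally show ?thesis .
qed

theorem theorem1p4:
  fixes b r q :: nat and D :: "nat set" and s l :: int and \<gamma> \<alpha> :: real
  assumes "b \<ge> 3"
    and "D \<subseteq> {0..<b}" and "2 \<le> card D" and "card D < b"
    and "r \<ge> 1" and "s \<noteq> 0" and "\<bar>s\<bar> \<noteq> int r"
    and "gcd s (int r) = 1" and "gcd (s * int r) (int b) = 1"
    and "\<gamma> = real_of_int s / real r * real b powi l"
    and "q \<ge> 1"
    and "real q > ln (real_of_int \<bar>s\<bar> + real r) / ln (real b / real (card D)) + 1"
  shows "upper_minkowski_dim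
           (((\<lambda>x. \<gamma> * x + \<alpha>) ` missing_digit_set b D) \<inter> missing_digit_set b D)
         \<le> ereal (ln (real (card D) ^ q - 1) / (real q * ln (real b)))"
proof -
  have "coprime (s * int r) (int b)"
    using assms(9) by (simp add: coprime_iff_gcd_eq_1)
  then have pair: "digit_pair (int b) (int r) s (int ` D)"
    using assms(2-4) by unfold_locales (auto simp: card_image)
  \<comment> \<open>Exponentiating the bound on \<open>q\<close> gives
    \<open>\<bar>s\<bar> + r < (b / card D) ^ (q - 1)\<close>, and the right-hand side is at most
    \<open>b ^ (q - 1)\<close>.\<close>
  have small: "int r + \<bar>s\<bar> < int b ^ (q - 1)"
  proof -
    have "real b / real (card D) > 1"
      using assms(3,4) by simp
    then have "ln (real_of_int \<bar>s\<bar> + real r) < real (q - 1) * ln (real b / real (card D))"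
    proof -
      have "ln (real b / real (card D)) > 0" using \<open>real b / real (card D) > 1\<close> by (rule ln_gt_zero)
      moreover have "ln (real_of_int \<bar>s\<bar> + real r) / ln (real b / real (card D)) < real (q - 1)"
        using assms(11,12) by (simp add: of_nat_diff)
      ultimately show ?thesis by (simp only: pos_divide_less_eq)
    qed
    also have "\<dots> = ln ((real b / real (card D)) ^ (q - 1))"
      using assms(3,4) by (simp add: ln_realpow)
    finally have "real_of_int \<bar>s\<bar> + real r < (real b / real (card D)) ^ (q - 1)"
      using assms(3-6) by (subst (asm) ln_less_cancel_iff) auto
    also have "\<dots> \<le> real b ^ (q - 1)"
      using assms(3) divide_left_mono[of 1 "real (card D)" "real b"] by (intro power_mono) auto
    finally have "real_of_int (int r + \<bar>s\<bar>) < real_of_int (int b ^ (q - 1))"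
      by simp
    then show ?thesis by (simp only: of_int_less_iff)
  qed
  \<comment> \<open>This makes the natural-number difference \<open>card D ^ q - 1\<close> agree
    with the real one and keeps it at least 1.\<close>
  have cardq: "2 \<le> card D ^ q"
    using assms(3,11) by (metis le_trans numeral_One one_le_numeral power_increasing power_one_right)
  have "upper_minkowski_dim (((\<lambda>x. \<gamma> * x + \<alpha>) ` missing_digit_set b D) \<inter> missing_digit_set b D)
      \<le> ereal (ln (real (card D) ^ q - 1) / ln (real b ^ q))"
  \<comment> \<open>One step of scale is one block of \<open>q\<close> digits: \<open>B\<close> is
    \<open>b ^ q\<close> and \<open>a\<close> is \<open>card D ^ q - 1\<close>.\<close>
  proof (rule upper_minkowski_dim_le)
    let ?c = "(2 * (nat \<bar>s\<bar> + r) + 2) * card D ^ nat \<bar>l\<bar>"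
    have "0 < ?c" using assms(3) by simp
    then have "1 \<le> ?c" by linarith
    then show "1 \<le> real ?c" by (metis of_nat_1 of_nat_le_iff)
    fix \<delta> and k :: nat assume "1 / (real b ^ q) ^ k \<le> \<delta>"
    then have "1 / real b ^ (q * k) \<le> \<delta>" by (simp add: power_mult)
    then have "interval_covering_number \<delta> ((\<lambda>x. \<gamma> * x + \<alpha>) ` missing_digit_set b D \<inter> missing_digit_set b D)
      \<le> ?c * (card D ^ q - 1) ^ k"
      using assms(1) by (intro intersection_covering_number_le[OF pair _ assms(2,5,7) small assms(10)]) simp_all
    then have "real (interval_covering_number \<delta> ((\<lambda>x. \<gamma> * x + \<alpha>) ` missing_digit_set b D \<inter> missing_digit_set b D))
      \<le> real (?c * (card D ^ q - 1) ^ k)"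
      by (simp only: of_nat_le_iff)
    also have "\<dots> = real ?c * (real (card D) ^ q - 1) ^ k"
      using cardq by (simp add: of_nat_diff)
    finally show "real (interval_covering_number \<delta> ((\<lambda>x. \<gamma> * x + \<alpha>) ` missing_digit_set b D \<inter> missing_digit_set b D))
      \<le> real ?c * (real (card D) ^ q - 1) ^ k" .
  next
    show "1 < real b ^ q" using assms(1,11) by (intro one_less_power) auto
    have "2 \<le> real (card D) ^ q" using cardq by (metis of_nat_le_iff of_nat_numeral of_nat_power)
    then show "1 \<le> real (card D) ^ q - 1" by simp
  qed
  then show ?thesis
    using assms(1) by (simp add: ln_realpow)
qed

end
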